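(* Let $\mathbb{M}^n=(\mathbb{R}^n,\|\cdot\|)$ be a Minkowski space and let $K\subset\mathbb{R}^n$ be a complete convex body in $\mathbb{M}^n$ consisting of more than one point. Then $$(s(K)+1)\,r(K)=r(K)+R(K)=\frac{s(K)+1}{s(K)}\,R(K)=D(K),$$ and therefore $$\frac{r(K)}{D(K)}=1-j(K)\ \ge\ 1-j(\mathbb{M}^n),$$ with equality in the last inequality if and only if $j(K)=j(\mathbb{M}^n)$.
   Context: A Minkowski space $\mathbb{M}^n=(\mathbb{R}^n,\|\cdot\|)$ is $\mathbb{R}^n$ with an arbitrary norm; $\mathbb{B}$ denotes its closed unit ball. A (convex) body is a nonempty compact convex set $K\subset\mathbb{R}^n$ (interior may be empty). All radii are taken with respect to $\mathbb{B}$. The circumradius is $R(K)=\inf\{\rho>0: K\subset c+\rho\mathbb{B}\text{ for some }c\in\mathbb{R}^n\}$; the inradius is $r(K)=\sup\{\rho>0: c+\rho\mathbb{B}\subset K\text{ for some }c\in\mathbb{R}^n\}$ (with $r(K)=0$ if there is no such $\rho$); the diameter is $D(K)=\sup_{x,y\in K}\|x-y\|$. The Jung ratio of $K$ (with $D(K)>0$) is $j(K)=R(K)/D(K)$, and the Jung constant $j(\mathbb{M}^n)$ is the maximum of $j(K)$ over all convex bodies $K\subset\mathbb{R}^n$ with $D(K)>0$. The Minkowski asymmetry of a convex body $K$ is $s(K)=\inf\{\rho>0:\exists c\in\mathbb{R}^n\text{ such that } -(K-c)\subset\rho(K-c)\}$. A convex body $K$ is complete if $D(K\cup\{x\})>D(K)$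 for all $x\notin K$. *)

theory Defs
  imports "HOL-Analysis.Analysis"
begin

text \<open>
  The arbitrary norm of a Minkowski space is an explicit function \<open>N\<close> on \<open>real ^ 'n\<close>,
  since the type-class norm there is the Euclidean one. All norms on \<open>real ^ 'n\<close> are
  equivalent, so compactness can be taken in the standard topology.
\<close>

definition is_norm :: "(real ^ 'n \<Rightarrow> real) \<Rightarrow> bool" where
  "is_norm N \<longleftrightarrow>
     (\<forall>x. 0 \<le> N x) \<and>
     (\<forall>x. N x = 0 \<longleftrightarrow> x = 0) \<and>
     (\<forall>a x. N (a *\<^sub>R x) = \<bar>a\<bar> * N x) \<and>
     (\<forall>x y. N (x + y) \<le> N x + N y)"

definition unit_ball :: "(real ^ 'n \<Rightarrow> real) \<Rightarrow> (real ^ 'n) set" where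
  "unit_ball N = {x. N x \<le> 1}"

definition convex_body :: "(real ^ 'n) set \<Rightarrow> bool" where
  "convex_body K \<longleftrightarrow> K \<noteq> {} \<and> compact K \<and> convex K"

definition circumradius :: "(real ^ 'n \<Rightarrow> real) \<Rightarrow> (real ^ 'n) set \<Rightarrow> real" where
  "circumradius N K =
     Inf {\<rho>. 0 < \<rho> \<and> (\<exists>c. K \<subseteq> (\<lambda>b. c + \<rho> *\<^sub>R b) ` unit_ball N)}"

definition inradius :: "(real ^ 'n \<Rightarrow> real) \<Rightarrow> (real ^ 'n) set \<Rightarrow> real" where
  "inradius N K =
     (let S = {\<rho>. 0 < \<rho> \<and> (\<exists>c. (\<lambda>b. c + \<rho> *\<^sub>R b) ` unit_ball N \<subseteq> K)}
      in if S = {} then 0 else Sup S)"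

definition diam :: "(real ^ 'n \<Rightarrow> real) \<Rightarrow> (real ^ 'n) set \<Rightarrow> real" where
  "diam N K = Sup {N (x - y) | x y. x \<in> K \<and> y \<in> K}"

definition jung_ratio :: "(real ^ 'n \<Rightarrow> real) \<Rightarrow> (real ^ 'n) set \<Rightarrow> real" where
  "jung_ratio N K = circumradius N K / diam N K"

text \<open>
  The set below is bounded above by 1 and, by Blaschke's selection theorem, its supremum is
  attained, so this is the maximal Jung ratio.
\<close>

definition jung_constant :: "(real ^ 'n \<Rightarrow> real) \<Rightarrow> real" where
  "jung_constant N = Sup {jung_ratio N K | K. convex_body K \<and> 0 < diam N K}"

definition asymmetry :: "(real ^ 'n) set \<Rightarrow> real" where
  "asymmetry K =
     Inf {\<rho>. 0 < \<rho> \<and> (\<exists>c. (\<lambda>x. - (x - c)) ` K \<subseteq> (\<lambda>x. \<rho> *\<^sub>R (x - c)) ` K)}"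

definition complete_body :: "(real ^ 'n \<Rightarrow> real) \<Rightarrow> (real ^ 'n) set \<Rightarrow> bool" where
  "complete_body N K \<longleftrightarrow> convex_body K \<and> (\<forall>x. x \<notin> K \<longrightarrow> diam N K < diam N (K \<union> {x}))"

end

theory Submission
  imports Defs
begin

text \<open>
  For a complete body \<open>K\<close> of diameter \<open>D\<close>, a point at distance at most \<open>D\<close> from all of \<open>K\<close>
  lies in \<open>K\<close>. Hence \<open>K\<close> lies in the ball of radius \<open>t < D\<close> about \<open>c\<close> iff it contains the
  concentric ball of radius \<open>D - t\<close>, which gives \<open>r + R = D\<close>. If \<open>-(K - c) \<subseteq> \<rho> (K - c)\<close>, then
  for \<open>x\<close> in \<open>K\<close> the point \<open>c - (x - c) / \<rho>\<close> is in \<open>K\<close> at distance \<open>(1 + 1/\<rho>) N (x - c)\<close> from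
  \<open>x\<close>, so \<open>K\<close> has circumradius at most \<open>\<rho> D / (\<rho> + 1)\<close>. Conversely the concentric balls of radii
  \<open>D - t\<close> and \<open>t\<close> show that \<open>t / (D - t)\<close> is an admissible \<open>\<rho>\<close>. Thus \<open>R = s D / (s + 1)\<close>.
\<close>

section \<open>Pointwise descriptions of the admissible radii and factors\<close>

definition circum_radii :: "(real ^ 'n \<Rightarrow> real) \<Rightarrow> (real ^ 'n) set \<Rightarrow> real set" where
  "circum_radii N K = {\<rho>. 0 < \<rho> \<and> (\<exists>c. \<forall>x\<in>K. N (x - c) \<le> \<rho>)}"

definition in_radii :: "(real ^ 'n \<Rightarrow> real) \<Rightarrow> (real ^ 'n) set \<Rightarrow> real set" where
  "in_radii N K = {\<rho>. 0 < \<rho> \<and> (\<exists>c. \<forall>x. N (x - c) \<le> \<rho> \<longrightarrow> x \<in> K)}"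

text \<open>Solving \<open>- (x - c) = \<rho> *\<^sub>R (y - c)\<close> for the point
  \<open>y\<close> of \<open>K\<close> produces the factor \<open>1 / \<rho>\<close> and avoids
  images of sets.\<close>

definition asym_factors :: "(real ^ 'n) set \<Rightarrow> real set" where
  "asym_factors K = {\<rho>. 0 < \<rho> \<and> (\<exists>c. \<forall>x\<in>K. c - (1 / \<rho>) *\<^sub>R (x - c) \<in> K)}"

section \<open>Elementary properties of an arbitrary norm\<close>

lemma
  assumes "is_norm N"
  shows is_norm_nonneg: "0 \<le> N x"
    and is_norm_eq_0: "N x = 0 \<longleftrightarrow> x = 0"
    and is_norm_scale: "N (a *\<^sub>R x) = \<bar>a\<bar> * N x"
    and is_norm_triangle: "N (x + y) \<le> N x + N y"
  using assms by (auto simp: is_norm_def)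

lemma is_norm_zero: "is_norm N \<Longrightarrow> N 0 = 0"
  by (simp add: is_norm_eq_0)

lemma is_norm_minus_commute:
  assumes "is_norm N"
  shows "N (x - y) = N (y - x)"
  using is_norm_scale[OF assms, of "-1" "x - y"] by simp

lemma is_norm_triangle_via:
  assumes "is_norm N"
  shows "N (x - y) \<le> N (x - z) + N (z - y)"
  using is_norm_triangle[OF assms, of "x - z" "z - y"] by simp

text \<open>Coordinate expansion and the triangle inequality. It makes Euclidean boundedness imply
  boundedness in \<open>N\<close>, so that the supremum in \<open>diam\<close> is a genuine
  one.\<close>

lemma is_norm_le_norm:
  fixes N :: "real ^ 'n \<Rightarrow> real"
  assumes N: "is_norm N"
  shows "N x \<le> (\<Sum>i\<in>UNIV. N (axis i 1)) * norm x"
proof -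
  have sum_le: "N (sum f A) \<le> (\<Sum>i\<in>A. N (f i))" if "finite A" for f :: "'n \<Rightarrow> real ^ 'n" and A
    using that
  proof (induction A rule: finite_induct)
    case empty
    then show ?case by (simp add: is_norm_zero[OF N])
  next
    case (insert a A)
    then show ?case using is_norm_triangle[OF N, of "f a" "sum f A"] by simp
  qed
  have "x = (\<Sum>i\<in>UNIV. x $ i *\<^sub>R axis i 1)"
    using basis_expansion[of x] by (simp add: scalar_mult_eq_scaleR)
  then have "N x \<le> (\<Sum>i\<in>UNIV. N (x $ i *\<^sub>R axis i 1))"
    using sum_le[of UNIV] by (metis finite)
  also have "\<dots> \<le> (\<Sum>i\<in>UNIV. N (axis i 1) * norm x)"
    by (intro sum_mono)
      (simp add: is_norm_scale[OF N] mult.commute[of "N _"] mult_right_mono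
        component_le_norm_cart is_norm_nonneg[OF N])
  finally show ?thesis by (simp add: sum_distrib_right)
qed

section \<open>Agreement with the original definitions\<close>

lemma mem_scaled_unit_ball:
  assumes N: "is_norm N" and "0 < \<rho>"
  shows "y \<in> (\<lambda>b. c + \<rho> *\<^sub>R b) ` unit_ball N \<longleftrightarrow> N (y - c) \<le> \<rho>"
proof
  assume "y \<in> (\<lambda>b. c + \<rho> *\<^sub>R b) ` unit_ball N"
  then show "N (y - c) \<le> \<rho>"
    using \<open>0 < \<rho>\<close> by (auto simp: unit_ball_def is_norm_scale[OF N])
next
  assume "N (y - c) \<le> \<rho>"
  then have "(1 / \<rho>) *\<^sub>R (y - c) \<in> unit_ball N"
    using \<open>0 < \<rho>\<close> by (simp add: unit_ball_def is_norm_scale[OF N])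
  moreover have "y = c + \<rho> *\<^sub>R ((1 / \<rho>) *\<^sub>R (y - c))"
    using \<open>0 < \<rho>\<close> by simp
  ultimately show "y \<in> (\<lambda>b. c + \<rho> *\<^sub>R b) ` unit_ball N" by blast
qed

lemma circumradius_eq_Inf:
  assumes "is_norm N"
  shows "circumradius N K = Inf (circum_radii N K)"
  unfolding circumradius_def circum_radii_def
  by (rule arg_cong[where f = Inf])
    (auto simp only: subset_eq mem_scaled_unit_ball[OF assms] cong: conj_cong)

lemma inradius_eq_Sup:
  assumes "is_norm N"
  shows "inradius N K = (if in_radii N K = {} then 0 else Sup (in_radii N K))"
proof -
  have "{\<rho>. 0 < \<rho> \<and> (\<exists>c. (\<lambda>b. c + \<rho> *\<^sub>R b) ` unit_ball N \<subseteq> K)} = in_radii N K"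
    unfolding in_radii_def
    by (auto simp only: subset_iff mem_scaled_unit_ball[OF assms] cong: conj_cong)
  then show ?thesis by (simp add: inradius_def)
qed

lemma reflection_subset_iff:
  fixes K :: "(real ^ 'n) set"
  assumes "0 < \<rho>"
  shows "(\<lambda>x. - (x - c)) ` K \<subseteq> (\<lambda>x. \<rho> *\<^sub>R (x - c)) ` K \<longleftrightarrow>
    (\<forall>x\<in>K. c - (1 / \<rho>) *\<^sub>R (x - c) \<in> K)"
proof -
  have eq: "- (x - c) = \<rho> *\<^sub>R (y - c) \<longleftrightarrow> y = c - (1 / \<rho>) *\<^sub>R (x - c)" for x y
  proof
    assume "- (x - c) = \<rho> *\<^sub>R (y - c)"
    then have "(1 / \<rho>) *\<^sub>R (- (x - c)) = y - c" using assms by simp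
    then show "y = c - (1 / \<rho>) *\<^sub>R (x - c)"
      by (metis add.commute diff_add_cancel scaleR_minus_right uminus_add_conv_diff)
  qed (use assms in simp)
  show ?thesis unfolding image_subset_iff image_iff eq by blast
qed

lemma asymmetry_eq_Inf: "asymmetry K = Inf (asym_factors K)"
  unfolding asymmetry_def asym_factors_def
  by (rule arg_cong[where f = Inf]) (auto simp only: reflection_subset_iff cong: conj_cong)

text \<open>The infimum defining the asymmetry is meaningful only over a nonempty set. As
  \<open>K\<close> may have empty interior, \<open>c\<close> is a relative interior point:
  reflections in \<open>c\<close> stay in the affine hull, and enough shrinking brings them into
  \<open>K\<close>.\<close>

lemma asym_factors_nonempty:
  fixes K :: "(real ^ 'n) set"
  assumes "convex_body K"
  shows "asym_factors K \<noteq> {}"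
proof -
  have "K \<noteq> {}" "compact K" "convex K" using assms by (auto simp: convex_body_def)
  then obtain c where "c \<in> rel_interior K" using rel_interior_eq_empty by blast
  then obtain e where c: "c \<in> K" and e: "e > 0" "cball c e \<inter> affine hull K \<subseteq> K"
    using rel_interior_cball[of K] by blast
  obtain M where M: "\<forall>x\<in>K. dist c x \<le> M"
    using compact_imp_bounded[OF \<open>compact K\<close>] bounded_any_center[of K c] by blast
  have "M \<ge> 0" using M c by fastforce
  \<comment> \<open>Shrinks distances up to \<open>M\<close> below \<open>e\<close>; the summand 1
    keeps \<open>\<rho>\<close> positive when \<open>M = 0\<close>.\<close>
  define \<rho> where "\<rho> = (M + 1) / e"
  have "\<rho> > 0" using \<open>M \<ge> 0\<close> e by (simp add: \<rho>_def)
  have "c - (1 / \<rho>) *\<^sub>R (x - c) \<in> K" if "x \<in> K" for x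
  proof -
    have "(1 + 1 / \<rho>) *\<^sub>R c + (- (1 / \<rho>)) *\<^sub>R x \<in> affine hull K"
      by (rule mem_affine[OF affine_affine_hull]) (use c that hull_inc in \<open>auto\<close>)
    moreover have "(1 + 1 / \<rho>) *\<^sub>R c + (- (1 / \<rho>)) *\<^sub>R x = c - (1 / \<rho>) *\<^sub>R (x - c)"
      by (simp add: algebra_simps)
    moreover have "dist c (c - (1 / \<rho>) *\<^sub>R (x - c)) \<le> e"
    proof -
      have "norm (x - c) \<le> M" using M that by (metis dist_commute dist_norm)
      then have "e * norm (x - c) \<le> e * (M + 1)" using e by (intro mult_left_mono) auto
      then have "norm (x - c) / \<rho> \<le> e"
        using \<open>M \<ge> 0\<close> e by (simp add: \<rho>_def field_simps)
      then show ?thesis using \<open>\<rho> > 0\<close> by (simp add: dist_norm)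
    qed
    ultimately show ?thesis using e by (auto simp: mem_cball)
  qed
  then show ?thesis using \<open>\<rho> > 0\<close> by (auto simp: asym_factors_def)
qed

section \<open>Diameter, completeness and the Jung constant\<close>

lemma norm_diff_le_diam:
  assumes N: "is_norm N" and "bounded K" "x \<in> K" "y \<in> K"
  shows "N (x - y) \<le> diam N K"
proof -
  define C where "C = (\<Sum>i\<in>UNIV. N (axis i 1))"
  have "C \<ge> 0" unfolding C_def by (intro sum_nonneg) (simp add: is_norm_nonneg[OF N])
  obtain b where b: "\<forall>x\<in>K. norm x \<le> b" using \<open>bounded K\<close> by (auto simp: bounded_iff)
  have "N (u - v) \<le> C * (b + b)" if "u \<in> K" "v \<in> K" for u v
  proof -
    have "N (u - v) \<le> C * norm (u - v)" unfolding C_def by (rule is_norm_le_norm[OF N])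
    also have "\<dots> \<le> C * (b + b)"
      using bspec[OF b that(1)] bspec[OF b that(2)] \<open>C \<ge> 0\<close> norm_triangle_ineq4[of u v]
      by (intro mult_left_mono) simp_all
    finally show ?thesis .
  qed
  then have "bdd_above {N (x - y) | x y. x \<in> K \<and> y \<in> K}" by (intro bdd_aboveI) blast
  then show ?thesis unfolding diam_def using assms(3,4) by (intro cSup_upper) auto
qed

text \<open>Otherwise adding \<open>y\<close> would leave the diameter unchanged, against
  completeness.\<close>

lemma complete_body_memI:
  assumes N: "is_norm N" and K: "complete_body N K"
    and y: "\<And>x. x \<in> K \<Longrightarrow> N (x - y) \<le> diam N K"
  shows "y \<in> K"
proof (rule ccontr)
  assume "y \<notin> K"
  have cb: "K \<noteq> {}" "bounded K"
    using K compact_imp_bounded by (auto simp: complete_body_def convex_body_def)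
  \<comment> \<open>Covers the pair \<open>u = v = y\<close>, whose distance is 0.\<close>
  have "0 \<le> diam N K" using y cb is_norm_nonneg[OF N] order_trans by blast
  then have "N (u - v) \<le> diam N K" if "u \<in> K \<union> {y}" "v \<in> K \<union> {y}" for u v
    using that y is_norm_minus_commute[OF N] norm_diff_le_diam[OF N cb(2)] is_norm_zero[OF N]
    by auto
  then have "diam N (K \<union> {y}) \<le> diam N K"
    unfolding diam_def[of N "K \<union> {y}"] by (intro cSup_least) auto
  with K \<open>y \<notin> K\<close> show False by (force simp: complete_body_def)
qed

lemma circum_radii_ge_half_diam:
  assumes N: "is_norm N" and "K \<noteq> {}" "t \<in> circum_radii N K"
  shows "diam N K / 2 \<le> t"
proof -
  obtain c where c: "\<forall>x\<in>K. N (x - c) \<le> t" using assms by (auto simp: circum_radii_def)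
  have "N (x - y) \<le> 2 * t" if "x \<in> K" "y \<in> K" for x y
    using is_norm_triangle_via[OF N, of x y c] is_norm_minus_commute[OF N, of c y]
      bspec[OF c that(1)] bspec[OF c that(2)] by simp
  then have "diam N K \<le> 2 * t"
    unfolding diam_def using \<open>K \<noteq> {}\<close> by (intro cSup_least) blast+
  then show ?thesis by simp
qed

lemma circum_radii_bdd_below: "bdd_below (circum_radii N K)"
  by (rule bdd_belowI[of _ 0]) (auto simp: circum_radii_def)

lemma asym_factors_bdd_below: "bdd_below (asym_factors K)"
  by (rule bdd_belowI[of _ 0]) (auto simp: asym_factors_def)

text \<open>A body lies in the ball of radius \<open>diam\<close> about any of its points, so all
  ratios are at most 1 and the supremum bounds each of them.\<close>

lemma jung_ratio_le_jung_constant: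
  assumes N: "is_norm N" and K: "convex_body K" "0 < diam N K"
  shows "jung_ratio N K \<le> jung_constant N"
proof -
  have "jung_ratio N L \<le> 1" if L: "convex_body L" "0 < diam N L" for L
  proof -
    have "L \<noteq> {}" "bounded L" using L compact_imp_bounded by (auto simp: convex_body_def)
    then have "\<exists>c. \<forall>x\<in>L. N (x - c) \<le> diam N L"
      using norm_diff_le_diam[OF N] by blast
    then have "diam N L \<in> circum_radii N L" using L by (simp add: circum_radii_def)
    then have "circumradius N L \<le> diam N L"
      unfolding circumradius_eq_Inf[OF N] by (rule cInf_lower[OF _ circum_radii_bdd_below])
    then show ?thesis using L by (simp add: jung_ratio_def)
  qed
  then have "bdd_above {jung_ratio N K | K. convex_body K \<and> 0 < diam N K}"
    by (intro bdd_aboveI[of _ 1]) blast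
  then show ?thesis unfolding jung_constant_def using K by (intro cSup_upper) auto
qed

section \<open>Passing between circumscribed balls, inscribed balls and asymmetry factors\<close>

lemma asym_factor_imp_circum_radius:
  assumes N: "is_norm N" and "bounded K" "0 < diam N K" and \<rho>: "\<rho> \<in> asym_factors K"
  shows "\<rho> * diam N K / (\<rho> + 1) \<in> circum_radii N K"
proof -
  obtain c where "\<rho> > 0" and c: "\<forall>x\<in>K. c - (1 / \<rho>) *\<^sub>R (x - c) \<in> K"
    using \<rho> by (auto simp: asym_factors_def)
  have "N (x - c) \<le> \<rho> * diam N K / (\<rho> + 1)" if "x \<in> K" for x
  proof -
    have "x - (c - (1 / \<rho>) *\<^sub>R (x - c)) = (1 + 1 / \<rho>) *\<^sub>R (x - c)"
      by (simp add: algebra_simps)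
    then have "(1 + 1 / \<rho>) * N (x - c) \<le> diam N K"
      using norm_diff_le_diam[OF N \<open>bounded K\<close> that, of "c - (1 / \<rho>) *\<^sub>R (x - c)"] c that
        is_norm_scale[OF N, of "1 + 1 / \<rho>" "x - c"] \<open>\<rho> > 0\<close> by simp
    then show ?thesis using \<open>\<rho> > 0\<close> by (simp add: field_simps)
  qed
  then show ?thesis using \<open>\<rho> > 0\<close> \<open>0 < diam N K\<close> by (auto simp: circum_radii_def)
qed

text \<open>The path through \<open>c\<close> has length at most \<open>t + (D - t) = D\<close>,
  where \<open>D\<close> is the diameter, so completeness applies.\<close>

lemma complete_body_contains_concentric_ball:
  assumes N: "is_norm N" and K: "complete_body N K"
    and c: "\<forall>x\<in>K. N (x - c) \<le> t" and "N (y - c) \<le> diam N K - t"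
  shows "y \<in> K"
proof (rule complete_body_memI[OF N K])
  fix x assume "x \<in> K"
  then show "N (x - y) \<le> diam N K"
    using is_norm_triangle_via[OF N, of x y c] is_norm_minus_commute[OF N, of c y] assms(4)
      bspec[OF c] by force
qed

lemma circum_radius_imp_in_radius:
  assumes "is_norm N" "complete_body N K" "t \<in> circum_radii N K" "t < diam N K"
  shows "diam N K - t \<in> in_radii N K"
  using assms complete_body_contains_concentric_ball[OF assms(1,2)]
  by (auto simp: circum_radii_def in_radii_def)

text \<open>Reflection in \<open>c\<close> with ratio \<open>(D - t) / t\<close>, where
  \<open>D\<close> is the diameter, sends the outer ball of radius \<open>t\<close> onto the inner
  ball of radius \<open>D - t\<close>.\<close>

lemma circum_radius_imp_asym_factor:
  assumes N: "is_norm N" and K: "complete_body N K"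
    and t: "t \<in> circum_radii N K" "t < diam N K"
  shows "t / (diam N K - t) \<in> asym_factors K"
proof -
  obtain c where "t > 0" and c: "\<forall>x\<in>K. N (x - c) \<le> t"
    using t by (auto simp: circum_radii_def)
  have "c - (1 / (t / (diam N K - t))) *\<^sub>R (x - c) \<in> K" if "x \<in> K" for x
  proof (rule complete_body_contains_concentric_ball[OF N K c])
    have "N (c - (1 / (t / (diam N K - t))) *\<^sub>R (x - c) - c) = (diam N K - t) / t * N (x - c)"
      using is_norm_scale[OF N, of "- ((diam N K - t) / t)" "x - c"] \<open>t > 0\<close> t by simp
    also have "\<dots> \<le> (diam N K - t) / t * t"
      using c that \<open>t > 0\<close> t by (intro mult_left_mono) auto
    finally show "N (c - (1 / (t / (diam N K - t))) *\<^sub>R (x - c) - c) \<le> diam N K - t"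
      using \<open>t > 0\<close> by simp
  qed
  then show ?thesis using \<open>t > 0\<close> t by (auto simp: asym_factors_def)
qed

text \<open>Supplies \<open>r + R \<le> D\<close>: a point of \<open>K\<close> and the far side of
  the inner ball are at most the diameter apart.\<close>

lemma in_radius_imp_circum_radius:
  assumes N: "is_norm N" and "bounded K" and \<sigma>: "\<sigma> \<in> in_radii N K"
  shows "diam N K - \<sigma> \<in> circum_radii N K"
proof -
  obtain c where "\<sigma> > 0" and c: "\<And>x. N (x - c) \<le> \<sigma> \<Longrightarrow> x \<in> K"
    using \<sigma> by (auto simp: in_radii_def)
  \<comment> \<open>Every \<open>x\<close> has an antipodal point of the inner ball, at distance \<open>N (x - c) + \<sigma>\<close>.\<close>
  have far: "N (x - c) + \<sigma> \<le> diam N K" if "x \<in> K" "x \<noteq> c" for x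
  proof -
    define k where "k = \<sigma> / N (x - c)"
    have "N (x - c) > 0"
      using is_norm_nonneg[OF N, of "x - c"] is_norm_eq_0[OF N, of "x - c"] that by simp
    then have k: "k > 0" "k * N (x - c) = \<sigma>" using \<open>\<sigma> > 0\<close> by (auto simp: k_def)
    have "N (c - k *\<^sub>R (x - c) - c) = \<sigma>"
      using is_norm_scale[OF N, of "- k" "x - c"] k by simp
    then have "c - k *\<^sub>R (x - c) \<in> K" by (intro c) simp
    then have "N (x - (c - k *\<^sub>R (x - c))) \<le> diam N K"
      using norm_diff_le_diam[OF N \<open>bounded K\<close>] that by blast
    moreover have "x - (c - k *\<^sub>R (x - c)) = (1 + k) *\<^sub>R (x - c)" by (simp add: algebra_simps)
    ultimately have "(1 + k) * N (x - c) \<le> diam N K"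
      using k by (simp add: is_norm_scale[OF N])
    then show ?thesis using k by (simp add: distrib_right)
  qed
  have "N (c - c) = 0" by (simp add: is_norm_zero[OF N])
  \<comment> \<open>The bound \<open>far\<close> omits \<open>x = c\<close>. Applied to
    \<open>c + u\<close> on the boundary of the inner ball it gives
    \<open>2 * \<sigma> \<le> D\<close>, hence a positive outer radius, which also handles the
    centre.\<close>
  define u where "u = (\<sigma> / N (axis undefined 1)) *\<^sub>R (axis undefined 1 :: real ^ 'a)"
  have "N (axis undefined 1 :: real ^ 'a) \<noteq> 0" using is_norm_eq_0[OF N] by (simp add: axis_eq_0_iff)
  then have "N u = \<sigma>"
    using \<open>\<sigma> > 0\<close> is_norm_nonneg[OF N] by (simp add: u_def is_norm_scale[OF N])
  moreover have "u \<noteq> 0" using \<open>N u = \<sigma>\<close> \<open>\<sigma> > 0\<close> is_norm_eq_0[OF N, of u] by auto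
  ultimately have "\<sigma> + \<sigma> \<le> diam N K" using far[of "c + u"] c[of "c + u"] by simp
  then have pos: "0 < diam N K - \<sigma>" using \<open>\<sigma> > 0\<close> by simp
  have "N (x - c) \<le> diam N K - \<sigma>" if "x \<in> K" for x
    using far[OF that] pos \<open>N (c - c) = 0\<close> by (cases "x = c") simp_all
  with pos show ?thesis unfolding circum_radii_def by blast
qed


section \<open>From admissible values to infima and suprema\<close>

theorem theorem1p2:
  fixes N :: "real ^ 'n \<Rightarrow> real" and K :: "(real ^ 'n) set"
  assumes "is_norm N"
    and "complete_body N K"
    and "\<exists>x\<in>K. \<exists>y\<in>K. x \<noteq> y"
  shows "(asymmetry K + 1) * inradius N K = inradius N K + circumradius N K \<and>
         inradius N K + circumradius N K = (asymmetry K + 1) / asymmetry K * circumradius N K \<and>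
         (asymmetry K + 1) / asymmetry K * circumradius N K = diam N K \<and>
         inradius N K / diam N K = 1 - jung_ratio N K \<and>
         1 - jung_ratio N K \<ge> 1 - jung_constant N \<and>
         (inradius N K / diam N K = 1 - jung_constant N \<longleftrightarrow> jung_ratio N K = jung_constant N)"
proof -
  note N = \<open>is_norm N\<close> and K = \<open>complete_body N K\<close>
  define D where "D = diam N K"
  define R where "R = circumradius N K"
  define r where "r = inradius N K"
  define s where "s = asymmetry K"
  have cb: "convex_body K" "K \<noteq> {}" "bounded K"
    using K compact_imp_bounded by (auto simp: complete_body_def convex_body_def)
  obtain x y where "x \<in> K" "y \<in> K" "x \<noteq> y" using assms(3) by blast
  then have "D > 0"
    using norm_diff_le_diam[OF N cb(3), of x y] is_norm_nonneg[OF N, of "x - y"]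
      is_norm_eq_0[OF N, of "x - y"] by (simp add: D_def)
  have R_lower: "R \<le> t" if "t \<in> circum_radii N K" for t
    unfolding R_def circumradius_eq_Inf[OF N] by (rule cInf_lower[OF that circum_radii_bdd_below])
  obtain \<rho>0 where \<rho>0: "\<rho>0 \<in> asym_factors K" using asym_factors_nonempty[OF cb(1)] by blast
  have asym_to_R: "\<rho> > 0 \<and> R \<le> \<rho> * D / (\<rho> + 1)" if "\<rho> \<in> asym_factors K" for \<rho>
    using R_lower asym_factor_imp_circum_radius[OF N cb(3) _ that] that \<open>D > 0\<close>
    by (auto simp: D_def asym_factors_def)
  have ne: "circum_radii N K \<noteq> {}"
    using asym_factor_imp_circum_radius[OF N cb(3) _ \<rho>0] \<open>D > 0\<close> by (auto simp: D_def)
  have R_greatest: "z \<le> R" if "\<And>t. t \<in> circum_radii N K \<Longrightarrow> z \<le> t" for z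
    unfolding R_def circumradius_eq_Inf[OF N] by (rule cInf_greatest[OF ne that])
  have "D / 2 \<le> R"
    using circum_radii_ge_half_diam[OF N cb(2)] by (intro R_greatest) (simp add: D_def)
  \<comment> \<open>A single finite factor already forces \<open>R < D\<close> strictly, so
    \<open>D - R\<close> may be divided by.\<close>
  have "\<rho>0 * D / (\<rho>0 + 1) < D" using asym_to_R[OF \<rho>0] \<open>D > 0\<close> by (simp add: field_simps)
  then have "R < D" using asym_to_R[OF \<rho>0] by simp
  \<comment> \<open>\<open>R / (D - R)\<close> inverts the map from \<open>\<rho>\<close> to
    \<open>\<rho> * D / (\<rho> + 1)\<close>.\<close>
  have "R / (D - R) \<le> s"
    unfolding s_def asymmetry_eq_Inf
  proof (rule cInf_greatest)
    fix \<rho> assume "\<rho> \<in> asym_factors K"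
    then have "\<rho> > 0" "R \<le> \<rho> * D / (\<rho> + 1)" using asym_to_R by auto
    then have "R * (\<rho> + 1) \<le> \<rho> * D" by (simp add: pos_le_divide_eq)
    then show "R / (D - R) \<le> \<rho>" using \<open>R < D\<close> by (simp add: field_simps)
  qed (use \<rho>0 in auto)
  moreover have "R / (D - R) > 0" using \<open>D / 2 \<le> R\<close> \<open>D > 0\<close> \<open>R < D\<close> by simp
  ultimately have "s > 0" by linarith
  have "s * D / (s + 1) \<le> R"
  proof (rule R_greatest)
    fix t assume t: "t \<in> circum_radii N K"
    show "s * D / (s + 1) \<le> t"
    \<comment> \<open>Only radii below \<open>D\<close> give asymmetry factors; for the others the
      bound is trivial.\<close>
    proof (cases "t < D")
      case True
      then have "s \<le> t / (D - t)"
        unfolding s_def asymmetry_eq_Inf D_def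
        by (intro cInf_lower[OF circum_radius_imp_asym_factor[OF N K t] asym_factors_bdd_below])
      then show ?thesis using True \<open>s > 0\<close> by (simp add: field_simps)
    next
      case False
      have "s * D / (s + 1) \<le> D" using \<open>s > 0\<close> \<open>D > 0\<close> by (simp add: field_simps)
      then show ?thesis using False by simp
    qed
  qed
  \<comment> \<open>The two bounds meet in this equation, from which the identities involving
    \<open>s\<close> follow once \<open>r = D - R\<close> is known.\<close>
  then have sR: "s * (D - R) = R"
    using \<open>R / (D - R) \<le> s\<close> \<open>R < D\<close> \<open>s > 0\<close> by (simp add: field_simps)
  have in_le: "\<sigma> \<le> D - R" if "\<sigma> \<in> in_radii N K" for \<sigma>
    using R_lower[OF in_radius_imp_circum_radius[OF N cb(3) that]] by (simp add: D_def)
  \<comment> \<open>A radius below \<open>D\<close> yields an inscribed ball, so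
    \<open>inradius\<close> is the supremum and not its default value 0.\<close>
  obtain t0 where "t0 \<in> circum_radii N K" "t0 < D"
    using R_greatest[of D] \<open>R < D\<close> by (meson not_le)
  then have in_ne: "in_radii N K \<noteq> {}"
    using circum_radius_imp_in_radius[OF N K] by (auto simp: D_def)
  then have r_eq: "r = Sup (in_radii N K)" by (simp add: r_def inradius_eq_Sup[OF N])
  have r_upper: "\<sigma> \<le> r" if "\<sigma> \<in> in_radii N K" for \<sigma>
    unfolding r_eq using in_le by (intro cSup_upper[OF that] bdd_aboveI)
  \<comment> \<open>Settles the case \<open>t \<ge> D\<close> below, where no inscribed ball is at
    hand: \<open>D - r < D \<le> t\<close>.\<close>
  have "0 < r" using in_ne r_upper by (force simp: in_radii_def)
  have "D - r \<le> R"
  proof (rule R_greatest)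
    fix t assume "t \<in> circum_radii N K"
    then show "D - r \<le> t"
      using r_upper circum_radius_imp_in_radius[OF N K, of t] \<open>0 < r\<close>
      by (cases "t < D") (force simp: D_def)+
  qed
  moreover have "r \<le> D - R" unfolding r_eq using in_le by (intro cSup_least[OF in_ne])
  ultimately have rR: "r = D - R" by simp
  have "jung_ratio N K \<le> jung_constant N"
    using jung_ratio_le_jung_constant[OF N cb(1)] \<open>D > 0\<close> by (simp add: D_def)
  moreover have "r / D = 1 - jung_ratio N K"
    using \<open>D > 0\<close> by (simp add: rR jung_ratio_def diff_divide_distrib flip: D_def R_def)
  moreover have "(s + 1) * r = r + R" using sR by (simp add: rR algebra_simps)
  moreover have "(s + 1) / s * R = D"
    using sR \<open>s > 0\<close> by (simp add: field_simps)
  ultimately show ?thesis using rR by (simp flip: D_def R_def r_def s_def)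
qed

end
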